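(* Let $n\ge 2$. There is no $n$-dimensional $2$-level polytope in $\mathbb{R}^n$ that is combinatorially equivalent to an $n$-dimensional double simplex, except in the plane; that is, such a $2$-level polytope exists if and only if $n=2$.
   Context: An $n$-dimensional double simplex is a bipyramid over a simplex of dimension $n-1$, i.e. the convex hull of an $(n-1)$-simplex $Q$ and a line segment, not contained in the affine hull of $Q$, which meets $Q$ in exactly one point, this point lying in the relative interiors of both the segment and $Q$. Two polytopes are combinatorially equivalent if their face lattices are isomorphic. Slack matrix: let $P\subset\mathbb{R}^n$ be a full-dimensional polytope with vertices $p_1,\dots,p_v$ and irredundant (facet) inequality representation $P=\{x\in\mathbb{R}^n:\beta_j-\langle a_j,x\rangle\ge 0,\ j=1,\dots,f\}$. The $v\times f$ nonnegative matrix with $(i,j)$-entry $\beta_j-\langle a_j,p_i\rangle$ is called a slack matrix of $P$ (defined up to positive scalings of its columns, since each facet inequality may be scaled by a positive number). An $n$-dimensional polytope $P\subset\mathbb{R}^n$ is $2$-level if it has a slack matrix all of whose entries are zero or one; geometrically, for each facet of $P$, all vertices of $P$ lie on the union of this facet and exactly one other parallel translate of the hyperplane spanning this facet. *)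

theory Defs
  imports "HOL-Analysis.Analysis"
begin

definition double_simplex :: "int \<Rightarrow> 'a::euclidean_space set \<Rightarrow> bool" where
  "double_simplex n D \<longleftrightarrow>
     (\<exists>Q a b z. (n - 1) simplex Q \<and>
        \<not> closed_segment a b \<subseteq> affine hull Q \<and>
        closed_segment a b \<inter> Q = {z} \<and>
        z \<in> rel_interior (closed_segment a b) \<and> z \<in> rel_interior Q \<and>
        D = convex hull (Q \<union> closed_segment a b))"

text \<open>
  Face lattices include the empty face and the polytope itself; a bijection that preserves and
  reflects inclusion is the same thing as a lattice isomorphism.
\<close>

definition combinatorially_equivalent ::
    "'a::euclidean_space set \<Rightarrow> 'b::euclidean_space set \<Rightarrow> bool" where
  "combinatorially_equivalent P P' \<longleftrightarrow>
     (\<exists>\<phi>. bij_betw \<phi> {F. F face_of P} {G. G face_of P'} \<and>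
        (\<forall>F G. F face_of P \<longrightarrow> G face_of P \<longrightarrow> (F \<subseteq> G \<longleftrightarrow> \<phi> F \<subseteq> \<phi> G)))"

text \<open>
  Irredundant means that no single inequality can be dropped. For a full-dimensional polytope
  the inequalities then correspond bijectively to the facets, each being determined up to a
  positive factor.
\<close>

definition irredundant_representation ::
    "'a::euclidean_space set \<Rightarrow> nat \<Rightarrow> (nat \<Rightarrow> 'a) \<Rightarrow> (nat \<Rightarrow> real) \<Rightarrow> bool" where
  "irredundant_representation P f a \<beta> \<longleftrightarrow>
     P = {x. \<forall>j<f. \<beta> j - a j \<bullet> x \<ge> 0} \<and>
     (\<forall>k<f. {x. \<forall>j\<in>{..<f} - {k}. \<beta> j - a j \<bullet> x \<ge> 0} \<noteq> P)"

text \<open>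
  A \<open>v \<times> f\<close> matrix is a function on pairs of indices, of which only the values with
  \<open>i < v\<close> and \<open>j < f\<close> matter. Since the representation is arbitrary, all positive scalings of
  the columns are slack matrices as well.
\<close>

definition slack_matrix_of ::
    "'a::euclidean_space set \<Rightarrow> nat \<Rightarrow> nat \<Rightarrow> (nat \<Rightarrow> nat \<Rightarrow> real) \<Rightarrow> bool" where
  "slack_matrix_of P v f S \<longleftrightarrow>
     polytope P \<and> aff_dim P = int DIM('a) \<and>
     (\<exists>p a \<beta>. bij_betw p {..<v} {x. x extreme_point_of P} \<and>
        irredundant_representation P f a \<beta> \<and>
        (\<forall>i<v. \<forall>j<f. S i j = \<beta> j - a j \<bullet> p i))"

definition two_level :: "'a::euclidean_space set \<Rightarrow> bool" where
  "two_level P \<longleftrightarrow>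
     (\<exists>v f S. slack_matrix_of P v f S \<and> (\<forall>i<v. \<forall>j<f. S i j \<in> {0, 1}))"

end

theory Submission
  imports Defs
begin

text \<open>
  Let \<open>V = C \<union> {a, b}\<close> be the vertices of the double simplex, \<open>C\<close> those of the simplex \<open>Q\<close> and
  \<open>a\<close>, \<open>b\<close> the ends of the segment. For \<open>q \<in> C\<close> the facet through \<open>a\<close> and \<open>C - {q}\<close> misses exactly
  \<open>q\<close> and \<open>b\<close>, and likewise with \<open>a\<close> and \<open>b\<close> exchanged. In a combinatorially equivalent 2-level
  polytope the corresponding columns of the slack matrix are therefore determined: they are the
  indicators of \<open>{q, b}\<close> and \<open>{q, a}\<close>. The \<open>n + 2\<close> vertices satisfy a nontrivial affine dependency
  \<open>u\<close>. Applying the slack functionals to it yields \<open>u q = - u b = - u a\<close> for all \<open>q \<in> C\<close>, so that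
  \<open>\<Sum>u = 0\<close> reads \<open>(2 - n) * u a = 0\<close> with \<open>u a \<noteq> 0\<close>. Conversely, the unit square is 2-level and is
  itself the double simplex spanned by its two diagonals.
\<close>

section \<open>Faces\<close>

text \<open>Inside a segment a linear functional is an average of its end values with positive
  weights, so it can equal the lower bound \<open>c\<close> there only if it does at both ends. The
  functional is an abstract linear map because later it arises by extension from a basis.\<close>

lemma face_of_Int_linear_minimum:
  fixes h :: "'a::euclidean_space \<Rightarrow> real"
  assumes "linear h" "convex S" "\<And>x. x \<in> S \<Longrightarrow> c \<le> h x"
  shows "S \<inter> {x. h x = c} face_of S"
  unfolding face_of_def
proof (intro conjI ballI impI)
  have "h -` {c} = {x. h x = c}"
    by auto
  then show "convex (S \<inter> {x. h x = c})"
    using assms convex_linear_vimage[of h "{c}"] by (simp add: convex_Int)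
next
  fix x y z
  assume x: "x \<in> S" and y: "y \<in> S" and z: "z \<in> S \<inter> {x. h x = c}" and "z \<in> open_segment x y"
  then obtain u where u: "0 < u" "u < 1" "z = (1 - u) *\<^sub>R x + u *\<^sub>R y"
    by (auto simp: in_segment)
  have "h z = (1 - u) * h x + u * h y"
    using assms(1) by (simp add: u(3) linear_add linear_scale)
  then have "(1 - u) * (h x - c) + u * (h y - c) = 0"
    using z by (simp add: algebra_simps)
  moreover have "(1 - u) * (h x - c) \<ge> 0" "u * (h y - c) \<ge> 0"
    using u assms(3)[OF x] assms(3)[OF y] by auto
  ultimately have "(1 - u) * (h x - c) = 0" "u * (h y - c) = 0"
    by linarith+
  then show "x \<in> S \<inter> {x. h x = c}" "y \<in> S \<inter> {x. h x = c}"
    using u x y by auto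
qed auto

text \<open>Extremality can be tested inside one face. Were \<open>x\<close> redundant, the hull
  would be that of \<open>S - {x}\<close>, and its face \<open>F\<close> the hull of those points of
  \<open>S - {x}\<close> that lie in \<open>F\<close>, so \<open>x\<close> would lie in that
  hull.\<close>

lemma extreme_point_of_convex_hull_face:
  fixes S :: "'a::euclidean_space set"
  assumes "finite S" "F face_of convex hull S" "x \<in> F" "x \<in> S"
    "x \<notin> convex hull (S \<inter> F - {x})"
  shows "x extreme_point_of convex hull S"
proof -
  have "x \<notin> convex hull (S - {x})"
  proof
    assume x: "x \<in> convex hull (S - {x})"
    then have eq: "convex hull S = convex hull (S - {x})"
      using hull_redundant_eq[of x convex "S - {x}"] assms(4) by (simp add: insert_absorb)
    have "compact (S - {x})"
      using assms(1) by (simp add: finite_imp_compact)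
    then obtain T where T: "T \<subseteq> S - {x}" "F = convex hull T"
      using face_of_convex_hull_subset assms(2) unfolding eq by metis
    then have "T \<subseteq> S \<inter> F - {x}"
      using hull_subset[of T convex] by blast
    then show False
      using hull_mono[of T _ convex] T(2) assms(3,5) by blast
  qed
  then show ?thesis
    using extreme_point_of_convex_hull_insert[of "S - {x}" x] assms(1,4)
    by (simp add: insert_absorb)
qed

text \<open>Links abstract faces to columns of the slack matrix. If all inequalities were strict at
  a relative interior point of \<open>F\<close>, that point would be interior to \<open>P\<close>,
  which is impossible on a proper face. An inequality tight there cuts out a face meeting the
  relative interior of \<open>F\<close>, hence containing \<open>F\<close>.\<close>

lemma face_of_irredundant_representation:
  fixes P :: "'a::euclidean_space set"
  assumes rep: "irredundant_representation P f a \<beta>" and dim: "aff_dim P = int DIM('a)"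
    and F: "F face_of P" "F \<noteq> P" "F \<noteq> {}"
  obtains j where "j < f" "F \<subseteq> {x. \<beta> j - a j \<bullet> x = 0}"
    "P \<inter> {x. \<beta> j - a j \<bullet> x = 0} face_of P" "P \<inter> {x. \<beta> j - a j \<bullet> x = 0} \<noteq> P"
proof -
  have P: "P = {x. \<forall>j<f. \<beta> j - a j \<bullet> x \<ge> 0}"
    and irr: "\<And>k. k < f \<Longrightarrow> {x. \<forall>j\<in>{..<f} - {k}. \<beta> j - a j \<bullet> x \<ge> 0} \<noteq> P"
    using rep unfolding irredundant_representation_def by blast+
  have "P = (\<Inter>j<f. {x. a j \<bullet> x \<le> \<beta> j})"
    by (auto simp: P)
  then have conv: "convex P"
    by (simp add: convex_INT convex_halfspace_le)
  obtain x where x: "x \<in> rel_interior F"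
    using F rel_interior_eq_empty face_of_imp_convex by blast
  then have xF: "x \<in> F" and xP: "x \<in> P"
    using rel_interior_subset F(1) face_of_imp_subset by blast+
  have "\<exists>j<f. \<beta> j - a j \<bullet> x \<le> 0"
  proof (rule ccontr)
    let ?U = "\<Inter>j<f. {x. a j \<bullet> x < \<beta> j}"
    assume "\<not> ?thesis"
    then have "x \<in> ?U"
      by (auto simp: not_le)
    moreover have "open ?U"
      by (intro open_INT) (auto simp: open_halfspace_lt)
    moreover have "?U \<subseteq> P"
      by (force simp: P)
    ultimately have "x \<in> interior P"
      by (meson interior_maximal subsetD)
    then show False
      using face_of_disjoint_interior[OF F(1,2)] xF by blast
  qed
  then obtain j where j: "j < f" "\<beta> j - a j \<bullet> x \<le> 0"
    by blast
  let ?G = "P \<inter> {x. \<beta> j - a j \<bullet> x = 0}"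
  have Geq: "?G = P \<inter> {x. a j \<bullet> x = \<beta> j}"
    by auto
  have G: "?G face_of P"
    unfolding Geq
    by (rule face_of_Int_supporting_hyperplane_le) (use conv j P in auto)
  have "x \<in> ?G"
    using j xP P by force
  then have "F \<subseteq> ?G"
    using subset_of_face_of[OF G face_of_imp_subset[OF F(1)]] x by blast
  moreover have "?G \<noteq> P"
  proof
    assume "?G = P"
    then have sub: "P \<subseteq> {x. a j \<bullet> x = \<beta> j}"
      unfolding Geq by blast
    show False
    \<comment> \<open>A zero normal makes the inequality read \<open>0 \<ge> 0\<close>, which
      irredundancy forbids; a nonzero one puts \<open>P\<close> in a hyperplane, against full
      dimension.\<close>
    proof (cases "a j = 0")
      case True
      then have "\<beta> j = 0"
        using sub xP by (auto split: if_splits)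
      then show False
        using irr[OF j(1)] True P by force
    next
      case False
      then show False
        using aff_dim_subset[OF sub] dim by simp
    qed
  qed
  ultimately show ?thesis
    using that[of j] G j(1) by blast
qed

section \<open>Double simplices\<close>

text \<open>Coordinates for a double simplex with base vertices \<open>C\<close> and apices
  \<open>a\<close>, \<open>b\<close>. Positive \<open>w\<close> and \<open>0 < t < 1\<close> say
  that the crossing point is relatively interior to base and segment. The conditions are symmetric
  in the apices, so by \<open>swap\<close> each result for \<open>a\<close> has a twin for
  \<open>b\<close>.\<close>

locale bipyramid =
  fixes C :: "'a::euclidean_space set" and a b :: 'a and w :: "'a \<Rightarrow> real" and t :: real
  assumes independent: "\<not> affine_dependent C"
    and weights: "\<And>v. v \<in> C \<Longrightarrow> 0 < w v" "sum w C = 1"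
    and t: "0 < t" "t < 1"
    and crossing: "(1 - t) *\<^sub>R a + t *\<^sub>R b = (\<Sum>v\<in>C. w v *\<^sub>R v)"
    and apex_a: "a \<notin> affine hull C"
    and apex_b: "b \<notin> affine hull C"
begin

lemma swap: "bipyramid C b a w (1 - t)"
  using independent weights t crossing apex_a apex_b
  by unfold_locales (simp_all add: add.commute)

lemma finite_base: "finite C"
  using independent aff_independent_finite by blast

lemma crossing_in_base: "(1 - t) *\<^sub>R a + t *\<^sub>R b \<in> convex hull C"
  unfolding crossing convex_hull_finite[OF finite_base]
  using weights by (auto intro!: exI[of _ w] less_imp_le)

lemma apices_distinct: "a \<noteq> b"
proof
  assume "a = b"
  then have "a \<in> convex hull C"
    using crossing_in_base by (simp flip: scaleR_left_distrib)
  then show False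
    using apex_a convex_hull_subset_affine_hull by blast
qed

abbreviation V where "V \<equiv> insert a (insert b C)"

abbreviation D where "D \<equiv> convex hull V"

lemma finite_vertices: "finite V"
  using finite_base by simp

lemma card_vertices: "card V = card C + 2"
proof -
  have "a \<notin> C" "b \<notin> C"
    using apex_a apex_b hull_inc by metis+
  then show ?thesis
    using finite_base apices_distinct by simp
qed

section \<open>Facets through one apex, and extreme points\<close>

lemma independent_insert: "\<not> affine_dependent (insert a C)"
  using independent apex_a affine_independent_insert by blast

text \<open>The vectors \<open>v - a\<close> with \<open>v \<in> C\<close> are linearly independent,
  so \<open>h\<close> may be prescribed as 1 on \<open>q - a\<close> and 0 on the others. Its value
  at \<open>b\<close> is then forced by the crossing relation.\<close>

lemma functional_exists:
  assumes q: "q \<in> C"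
  obtains h :: "'a \<Rightarrow> real" where "linear h" "\<And>v. v \<in> C - {q} \<Longrightarrow> h v = h a" "h a < h q" "h a < h b"
proof -
  have aC: "a \<notin> C"
    using apex_a hull_inc by metis
  then have ind: "independent ((\<lambda>x. - a + x) ` C)"
    using independent_insert affine_dependent_iff_dependent by blast
  obtain h :: "'a \<Rightarrow> real" where h: "linear h"
    "\<forall>x\<in>(\<lambda>x. - a + x) ` C. h x = (if x = - a + q then 1 else 0)"
    using linear_independent_extend[OF ind, of "\<lambda>x. if x = - a + q then 1 else 0"] by blast
  have hC: "h v = h a + (if v = q then 1 else 0)" if "v \<in> C" for v
  proof -
    have "h (- a + v) = (if v = q then 1 else 0)"
      using h(2) that by auto
    then show ?thesis
      using linear_add[OF h(1), of "- a" v] linear_neg[OF h(1), of a] by simp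
  qed
  \<comment> \<open>Evaluating \<open>h\<close> on both sides of \<open>crossing\<close> yields
    \<open>t * (h b - h a) = w q\<close>, which is positive.\<close>
  have "(1 - t) * h a + t * h b = h (\<Sum>v\<in>C. w v *\<^sub>R v)"
    by (simp add: linear_add[OF h(1)] linear_scale[OF h(1)] flip: crossing)
  also have "\<dots> = (\<Sum>v\<in>C. w v * h v)"
    by (simp add: linear_sum[OF h(1)] linear_scale[OF h(1)])
  also have "\<dots> = (\<Sum>v\<in>C. w v * h a + (if v = q then w v else 0))"
    by (rule sum.cong) (auto simp: hC algebra_simps)
  also have "\<dots> = h a + w q"
    using q finite_base weights(2) by (simp add: sum.distrib flip: sum_distrib_right)
  finally have "t * (h b - h a) = w q"
    by (simp add: algebra_simps)
  then have "h a < h b"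
    using weights(1)[OF q] t by (smt (verit) mult_nonneg_nonpos)
  then show ?thesis
    using that[of h] h(1) hC q by auto
qed

text \<open>\<open>H\<close> is where the functional of \<open>functional_exists\<close> is minimal
  on \<open>D\<close>; it is proper because \<open>b\<close> lies strictly above the
  minimum.\<close>

lemma facet_exists:
  assumes q: "q \<in> C"
  obtains H where "H face_of D" "insert a (C - {q}) \<subseteq> H" "H \<noteq> D"
proof -
  obtain h :: "'a \<Rightarrow> real" where h: "linear h" "\<And>v. v \<in> C - {q} \<Longrightarrow> h v = h a" "h a < h q" "h a < h b"
    using functional_exists[OF q] by blast
  have "V \<subseteq> h -` {h a..}"
    using h(2-4) by force
  moreover have "convex (h -` {h a..})"
    using h(1) by (intro convex_linear_vimage) auto
  ultimately have ge: "h a \<le> h x" if "x \<in> D" for x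
    using that hull_minimal[of V _ convex] by blast
  let ?H = "D \<inter> {x. h x = h a}"
  have "?H face_of D"
    using face_of_Int_linear_minimum[OF h(1) _ ge] by simp
  moreover have "insert a (C - {q}) \<subseteq> ?H"
    using h(2) by (auto simp: hull_inc)
  moreover have "b \<in> D" "b \<notin> ?H"
    using h(4) by (auto simp: hull_inc)
  ultimately show ?thesis
    using that[of ?H] by blast
qed

lemma face_with_all_vertices:
  assumes "H face_of D" "V \<subseteq> H"
  shows "H = D"
proof (rule subset_antisym)
  show "D \<subseteq> H"
    using assms(2) face_of_imp_convex[OF assms(1)] by (rule hull_minimal)
qed (rule face_of_imp_subset[OF assms(1)])

text \<open>\<open>q\<close> and \<open>b\<close> lie in \<open>H\<close> together or not at all.
  With \<open>q\<close>, all of \<open>C\<close> is in \<open>H\<close>, hence so is the crossing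
  point, which is inside the segment from \<open>a\<close> to \<open>b\<close>; with
  \<open>b\<close>, the crossing point is in \<open>H\<close> and is relatively interior to the
  base. Both in \<open>H\<close> would give \<open>H = D\<close>. The claim covers every such face,
  since it is later applied to one that comes from a slack column.\<close>

lemma facet_misses:
  assumes q: "q \<in> C" and H: "H face_of D" "insert a (C - {q}) \<subseteq> H" "H \<noteq> D"
  shows "q \<notin> H" "b \<notin> H"
proof -
  let ?z = "(1 - t) *\<^sub>R a + t *\<^sub>R b"
  have conv: "convex H"
    using H(1) face_of_imp_convex by blast
  have VD: "V \<subseteq> D"
    by (rule hull_subset)
  have zab: "?z \<in> open_segment a b"
    using apices_distinct t by (auto simp: in_segment)
  have b_if_q: "b \<in> H" if "q \<in> H"
  proof -
    have "C \<subseteq> H"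
      using that H(2) by blast
    then have "?z \<in> H"
      using crossing_in_base hull_minimal[of C H convex] conv by blast
    then show "b \<in> H"
      using face_ofD[OF H(1) zab] VD by blast
  qed
  have q_if_b: "q \<in> H" if "b \<in> H"
  proof -
    have z: "?z \<in> H"
      using conv H(2) that t by (intro convexD) auto
    have "?z \<in> rel_interior (convex hull C)"
      unfolding rel_interior_convex_hull_explicit[OF independent]
      using weights by (auto simp: crossing intro!: exI[of _ w])
    then have "rel_interior (convex hull C) \<inter> H \<noteq> {}"
      using z by blast
    moreover have "convex hull C \<subseteq> D"
      by (intro hull_mono) auto
    ultimately have "convex hull C \<subseteq> H"
      using subset_of_face_of[OF H(1)] by blast
    then show "q \<in> H"
      using q hull_subset[of C convex] by blast
  qed
  have "\<not> (q \<in> H \<and> b \<in> H)"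
  proof
    assume "q \<in> H \<and> b \<in> H"
    then have "V \<subseteq> H"
      using H(2) by blast
    then show False
      using face_with_all_vertices[OF H(1)] H(3) by simp
  qed
  then show "q \<notin> H" "b \<notin> H"
    using b_if_q q_if_b by blast+
qed

text \<open>A facet that omits some base vertex \<open>q\<close> other than \<open>v\<close>, and
  with it \<open>b\<close>, has all its vertices in the affinely independent set
  \<open>insert a C\<close>, where \<open>v\<close> is not in the hull of the rest.\<close>

lemma extreme_point_insert:
  assumes "2 \<le> card C" "v \<in> insert a C"
  shows "v extreme_point_of D"
proof -
  have "\<not> C \<subseteq> {v}"
    using assms(1) card_mono[of "{v}" C] by auto
  then obtain q where q: "q \<in> C" "q \<noteq> v"
    by blast
  obtain H where H: "H face_of D" "insert a (C - {q}) \<subseteq> H" "H \<noteq> D"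
    by (rule facet_exists[OF q(1)])
  have "b \<notin> H"
    using facet_misses[OF q(1) H] by simp
  then have "V \<inter> H - {v} \<subseteq> insert a C - {v}"
    by blast
  moreover have "v \<notin> affine hull (insert a C - {v})"
    using independent_insert assms(2) unfolding affine_dependent_def by blast
  ultimately have "v \<notin> convex hull (V \<inter> H - {v})"
    by (meson convex_hull_subset_affine_hull hull_mono subsetD)
  moreover have "v \<in> H" "v \<in> V"
    using H(2) q(2) assms(2) by blast+
  ultimately show ?thesis
    using extreme_point_of_convex_hull_face[OF finite_vertices H(1)] by simp
qed

end

lemma (in bipyramid) extreme_point:
  assumes "2 \<le> card C" "v \<in> V"
  shows "v extreme_point_of D"
proof (cases "v = b")
  case True
  \<comment> \<open>The apex \<open>b\<close> plays the role of \<open>a\<close> in the swapped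
    bipyramid, which has the same vertices.\<close>
  have "insert b (insert a C) = V"
    by (rule insert_commute)
  then show ?thesis
    using bipyramid.extreme_point_insert[OF swap assms(1), of v] True by simp
next
  case False
  then show ?thesis
    using extreme_point_insert[OF assms(1)] assms(2) by blast
qed

text \<open>Solving for \<open>b\<close> gives an affine combination with coefficients
  \<open>1 - 1/t\<close> and \<open>1/t\<close>. Since the crossing point is in the affine hull of
  the base, one apex in that hull would force the other into it.\<close>

lemma affine_segment_endpoint:
  assumes "affine S" "a \<in> S" "(1 - t) *\<^sub>R a + t *\<^sub>R b \<in> S" "t \<noteq> 0"
  shows "b \<in> S"
proof -
  have "(1 - t) *\<^sub>R a + t *\<^sub>R b = a + t *\<^sub>R (b - a)"
    by (simp add: scaleR_diff_left scaleR_diff_right)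
  then have "(1 / t) *\<^sub>R ((1 - t) *\<^sub>R a + t *\<^sub>R b) = (1 / t) *\<^sub>R a + (1 / t) *\<^sub>R (t *\<^sub>R (b - a))"
    by (simp only: scaleR_add_right)
  also have "(1 / t) *\<^sub>R (t *\<^sub>R (b - a)) = b - a"
    using assms(4) by (simp only: scaleR_scaleR) simp
  finally have "b = (1 - 1 / t) *\<^sub>R a + (1 / t) *\<^sub>R ((1 - t) *\<^sub>R a + t *\<^sub>R b)"
    by (simp add: scaleR_diff_left)
  then show ?thesis
    using mem_affine[OF assms(1-3), of "1 - 1 / t" "1 / t"] by simp
qed

lemma double_simplex_bipyramid:
  fixes D :: "'a::euclidean_space set"
  assumes "double_simplex n D"
  obtains C a b w t where "bipyramid C a b w t" "D = convex hull (insert a (insert b C))"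
    "int (card C) = n"
proof -
  obtain Q a b z where Q: "(n - 1) simplex Q" "\<not> closed_segment a b \<subseteq> affine hull Q"
    and z: "closed_segment a b \<inter> Q = {z}"
      "z \<in> rel_interior (closed_segment a b)" "z \<in> rel_interior Q"
    and D: "D = convex hull (Q \<union> closed_segment a b)"
    using assms unfolding double_simplex_def by blast
  obtain C where C: "\<not> affine_dependent C" "int (card C) = n" "Q = convex hull C"
    using Q(1) unfolding simplex by auto
  have aff: "affine hull Q = affine hull C"
    using C(3) affine_hull_convex_hull by simp
  have zC: "z \<in> affine hull C"
    using z(1) aff hull_subset[of Q affine] by blast
  \<comment> \<open>A degenerate segment would be just \<open>{z}\<close>, which lies in the affine
    hull of \<open>Q\<close>.\<close>
  have "a \<noteq> b"
    using z(1) Q(2) aff zC by auto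
  then have "z \<in> open_segment a b"
    using z(2) rel_interior_closed_segment[of a b] by simp
  then obtain t where t: "0 < t" "t < 1" "z = (1 - t) *\<^sub>R a + t *\<^sub>R b"
    by (auto simp: in_segment)
  obtain w where w: "\<forall>v\<in>C. 0 < w v" "sum w C = 1" "(\<Sum>v\<in>C. w v *\<^sub>R v) = z"
    using z(3) rel_interior_convex_hull_explicit[OF C(1)] C(3) by auto
  have apices: "\<not> (a \<in> affine hull C \<and> b \<in> affine hull C)"
    using Q(2) aff closed_segment_subset[of a "affine hull C" b]
    by (metis affine_affine_hull affine_imp_convex)
  have a: "a \<notin> affine hull C"
    using affine_segment_endpoint[of "affine hull C" a t b] apices zC t by auto
  have b: "b \<notin> affine hull C"
    using affine_segment_endpoint[of "affine hull C" b "1 - t" a] apices zC t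
    by (auto simp: add.commute)
  have "bipyramid C a b w t"
    using C(1) w t a b by unfold_locales auto
  moreover have "D = convex hull (insert a (insert b C))"
  proof -
    have "D = convex hull (convex hull C \<union> convex hull {a, b})"
      using D C(3) by (simp add: segment_convex_hull)
    also have "\<dots> = convex hull (C \<union> {a, b})"
      by (simp only: hull_Un_left[symmetric] hull_Un_right[symmetric])
    finally show ?thesis
      by (simp add: Un_commute)
  qed
  ultimately show ?thesis
    using that C(2) by blast
qed

section \<open>Two-level polytopes\<close>

lemma two_level_representation:
  fixes P :: "'a::euclidean_space set"
  assumes "two_level P"
  obtains f a \<beta> where "polytope P" "aff_dim P = int DIM('a)" "irredundant_representation P f a \<beta>"
    "\<And>x j. x extreme_point_of P \<Longrightarrow> j < f \<Longrightarrow> \<beta> j - a j \<bullet> x \<in> {0, 1}"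
proof -
  obtain v f S where "slack_matrix_of P v f S" and S: "\<forall>i<v. \<forall>j<f. S i j \<in> {0, 1}"
    using assms unfolding two_level_def by blast
  then obtain p a \<beta> where P: "polytope P" "aff_dim P = int DIM('a)"
      "irredundant_representation P f a \<beta>"
    and p: "bij_betw p {..<v} {x. x extreme_point_of P}"
    and Seq: "\<forall>i<v. \<forall>j<f. S i j = \<beta> j - a j \<bullet> p i"
    unfolding slack_matrix_of_def by blast
  have "\<beta> j - a j \<bullet> x \<in> {0, 1}" if x: "x extreme_point_of P" and j: "j < f" for x j
  proof -
    obtain i where "i < v" "x = p i"
      using x bij_betw_imp_surj_on[OF p] by blast
    then show ?thesis
      using S Seq j by metis
  qed
  then show ?thesis
    using that P by blast
qed

section \<open>Transfer of incidences and slack along a face lattice isomorphism\<close>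

lemma combinatorially_equivalent_iso:
  assumes "combinatorially_equivalent P P'"
  obtains \<phi> \<psi> where "\<forall>F. F face_of P \<longrightarrow> \<phi> F face_of P'" "\<forall>G. G face_of P' \<longrightarrow> \<psi> G face_of P"
    "\<forall>G. G face_of P' \<longrightarrow> \<phi> (\<psi> G) = G"
    "\<forall>F G. F face_of P \<longrightarrow> G face_of P \<longrightarrow> (F \<subseteq> G \<longleftrightarrow> \<phi> F \<subseteq> \<phi> G)"
proof -
  obtain \<phi> where bij: "bij_betw \<phi> {F. F face_of P} {G. G face_of P'}"
    and mono: "\<forall>F G. F face_of P \<longrightarrow> G face_of P \<longrightarrow> (F \<subseteq> G \<longleftrightarrow> \<phi> F \<subseteq> \<phi> G)"
    using assms unfolding combinatorially_equivalent_def by blast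
  let ?\<psi> = "inv_into {F. F face_of P} \<phi>"
  show ?thesis
  proof (rule that[of \<phi> ?\<psi>])
    show "\<forall>F. F face_of P \<longrightarrow> \<phi> F face_of P'"
      using bij bij_betwE by blast
    show "\<forall>G. G face_of P' \<longrightarrow> ?\<psi> G face_of P"
      using bij_betwE[OF bij_betw_inv_into[OF bij]] by blast
    show "\<forall>G. G face_of P' \<longrightarrow> \<phi> (?\<psi> G) = G"
      using bij_betw_inv_into_right[OF bij] by blast
  qed (rule mono)
qed

text \<open>Vertices are the atoms of the face lattice. The nonempty face \<open>\<psi> {v}\<close>
  has an extreme point \<open>x\<close>, and \<open>\<phi> {x}\<close> is then a nonempty subset of
  \<open>{v}\<close>.\<close>

lemma combinatorially_equivalent_vertex:
  fixes P :: "'a::euclidean_space set" and D :: "'b::euclidean_space set"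
  assumes P: "polytope P"
    and \<psi>: "\<And>G. G face_of D \<Longrightarrow> \<psi> G face_of P" "\<And>G. G face_of D \<Longrightarrow> \<phi> (\<psi> G) = G"
    and mono: "\<And>F G. F face_of P \<Longrightarrow> G face_of P \<Longrightarrow> F \<subseteq> G \<longleftrightarrow> \<phi> F \<subseteq> \<phi> G"
    and v: "v extreme_point_of D"
  shows "\<exists>x. x extreme_point_of P \<and> \<phi> {x} = {v}"
proof -
  have fv: "{v} face_of D"
    using v by (simp add: face_of_singleton)
  have "\<phi> {} \<subseteq> \<phi> (\<psi> {})"
    using mono \<psi>(1) empty_face_of empty_subsetI by metis
  then have bot: "\<phi> {} = {}"
    using \<psi>(2) empty_face_of by blast
  have "\<psi> {v} \<noteq> {}"
    using \<psi>(2)[OF fv] bot by force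
  moreover have "compact (\<psi> {v})" "convex (\<psi> {v})"
    using \<psi>(1)[OF fv] face_of_imp_compact face_of_imp_convex P polytope_imp_compact
      polytope_imp_convex by blast+
  ultimately obtain x where "x extreme_point_of \<psi> {v}"
    using extreme_point_exists_convex by blast
  then have x: "{x} face_of \<psi> {v}"
    by (simp add: face_of_singleton)
  then have xP: "{x} face_of P"
    using \<psi>(1)[OF fv] face_of_trans by blast
  have "\<phi> {x} \<subseteq> {v}"
    using mono[OF xP \<psi>(1)[OF fv]] face_of_imp_subset[OF x] \<psi>(2)[OF fv] by simp
  moreover have "\<not> \<phi> {x} \<subseteq> {}"
    using mono[OF xP empty_face_of] bot by simp
  ultimately have "\<phi> {x} = {v}"
    by blast
  then show ?thesis
    using xP by (auto simp: face_of_singleton)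
qed

text \<open>The facet \<open>H\<close> of \<open>D\<close> through \<open>a\<close> and
  \<open>C - {q}\<close> pulls back to a face of \<open>P\<close>, which lies in the zero set of
  some inequality \<open>j\<close>. The image of that zero face is proper and contains
  \<open>H\<close>, so \<open>facet_misses\<close> determines which vertices it contains. This fixes
  the zeros of column \<open>j\<close>, and 2-levelness makes its other entries 1.\<close>

lemma (in bipyramid) slack_column:
  fixes P :: "'b::euclidean_space set"
  assumes P: "polytope P" "irredundant_representation P f A \<beta>" "aff_dim P = int DIM('b)"
    and slack: "\<And>x j. x extreme_point_of P \<Longrightarrow> j < f \<Longrightarrow> \<beta> j - A j \<bullet> x \<in> {0, 1}"
    and \<phi>: "\<And>F. F face_of P \<Longrightarrow> \<phi> F face_of D"
    and \<psi>: "\<And>G. G face_of D \<Longrightarrow> \<psi> G face_of P" "\<And>G. G face_of D \<Longrightarrow> \<phi> (\<psi> G) = G"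
    and mono: "\<And>F G. F face_of P \<Longrightarrow> G face_of P \<Longrightarrow> F \<subseteq> G \<longleftrightarrow> \<phi> F \<subseteq> \<phi> G"
    and g: "\<And>v. v \<in> V \<Longrightarrow> g v extreme_point_of P" "\<And>v. v \<in> V \<Longrightarrow> \<phi> {g v} = {v}"
    and q: "q \<in> C"
  obtains j where "\<And>v. v \<in> V \<Longrightarrow> \<beta> j - A j \<bullet> g v = (if v \<in> {q, b} then 1 else 0)"
proof -
  \<comment> \<open>Incidence of a vertex with a face is inclusion of a singleton face, so the
    isomorphism preserves it.\<close>
  have mem: "g v \<in> F \<longleftrightarrow> v \<in> \<phi> F" if "v \<in> V" "F face_of P" for v F
    using mono[of "{g v}" F] g that by (simp add: face_of_singleton)
  have PP: "P face_of P" and DD: "D face_of D"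
    using P(1) by (simp_all add: face_of_refl polytope_imp_convex)
  have top: "\<phi> P = D"
    using mono[OF \<psi>(1)[OF DD] PP] \<psi>(2)[OF DD] face_of_imp_subset[OF \<psi>(1)[OF DD]]
      face_of_imp_subset[OF \<phi>[OF PP]] by blast
  obtain H where H: "H face_of D" "insert a (C - {q}) \<subseteq> H" "H \<noteq> D"
    by (rule facet_exists[OF q])
  have F: "\<psi> H face_of P" "\<phi> (\<psi> H) = H"
    using \<psi> H(1) by blast+
  have "\<psi> H \<noteq> P" "\<psi> H \<noteq> {}"
    using F(2) top H(2,3) mem[OF _ F(1), of a] by auto
  then obtain j where j: "j < f" "\<psi> H \<subseteq> {x. \<beta> j - A j \<bullet> x = 0}"
    and G: "P \<inter> {x. \<beta> j - A j \<bullet> x = 0} face_of P" "P \<inter> {x. \<beta> j - A j \<bullet> x = 0} \<noteq> P"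
    using face_of_irredundant_representation[OF P(2,3) F(1)] by metis
  let ?G = "P \<inter> {x. \<beta> j - A j \<bullet> x = 0}"
  have "\<psi> H \<subseteq> ?G"
    using j(2) face_of_imp_subset[OF F(1)] by blast
  then have "H \<subseteq> \<phi> ?G"
    using mono[OF F(1) G(1)] F(2) by simp
  then have HG: "insert a (C - {q}) \<subseteq> \<phi> ?G"
    using H(2) by blast
  have "\<phi> ?G \<noteq> D"
    using mono[OF PP G(1)] top G(2) by blast
  then have miss: "q \<notin> \<phi> ?G" "b \<notin> \<phi> ?G"
    using facet_misses[OF q \<phi>[OF G(1)] HG] by blast+
  show ?thesis
  proof (rule that[of j])
    fix v assume v: "v \<in> V"
    have "g v \<in> P"
      using g(1)[OF v] by (simp add: extreme_point_of_def)
    then have "\<beta> j - A j \<bullet> g v = 0 \<longleftrightarrow> v \<in> \<phi> ?G"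
      using mem[OF v G(1)] by simp
    moreover have "v \<in> \<phi> ?G \<longleftrightarrow> v \<notin> {q, b}"
      using v HG miss by blast
    ultimately show "\<beta> j - A j \<bullet> g v = (if v \<in> {q, b} then 1 else 0)"
      using slack[OF g(1)[OF v] j(1)] by auto
  qed
qed

text \<open>An affine functional sums to zero against an affine dependency; with a 0/1 column only
  the terms at \<open>q\<close> and \<open>b\<close> survive.\<close>

lemma (in bipyramid) affine_dependency_slack:
  fixes g :: "'a \<Rightarrow> 'b::euclidean_space"
  assumes u: "sum u V = 0" "(\<Sum>v\<in>V. u v *\<^sub>R g v) = 0"
    and col: "\<And>v. v \<in> V \<Longrightarrow> \<beta> - A \<bullet> g v = (if v \<in> {q, b} then 1 else 0)"
    and q: "q \<in> C"
  shows "u q + u b = 0"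
proof -
  have "q \<noteq> b"
    using q apex_b hull_inc by metis
  have "(\<Sum>v\<in>V. u v * (\<beta> - A \<bullet> g v)) = \<beta> * sum u V - A \<bullet> (\<Sum>v\<in>V. u v *\<^sub>R g v)"
    by (simp only: right_diff_distrib sum_subtractf inner_sum_right inner_scaleR_right
        sum_distrib_left mult.commute)
  then have "0 = (\<Sum>v\<in>V. u v * (\<beta> - A \<bullet> g v))"
    using u by simp
  also have "\<dots> = (\<Sum>v\<in>V. if v \<in> {q, b} then u v else 0)"
    by (rule sum.cong) (simp_all add: col)
  also have "\<dots> = sum u {q, b}"
    using q finite_vertices by (intro sum.mono_neutral_cong_right) auto
  finally show ?thesis
    using \<open>q \<noteq> b\<close> by simp
qed

theorem two_level_double_simplex_dimension:
  fixes P :: "'a::euclidean_space set" and D :: "'b::euclidean_space set"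
  assumes "two_level P" "double_simplex (int DIM('a)) D" "combinatorially_equivalent P D"
    and "2 \<le> DIM('a)"
  shows "DIM('a) = 2"
proof -
  obtain f A \<beta> where P: "polytope P" "irredundant_representation P f A \<beta>" "aff_dim P = int DIM('a)"
    and slack: "\<And>x j. x extreme_point_of P \<Longrightarrow> j < f \<Longrightarrow> \<beta> j - A j \<bullet> x \<in> {0, 1}"
    using two_level_representation[OF assms(1)] by metis
  obtain C a b w t where bp: "bipyramid C a b w t"
    and D: "D = convex hull (insert a (insert b C))" and card: "card C = DIM('a)"
    using double_simplex_bipyramid[OF assms(2)] by (metis of_nat_eq_iff)
  interpret bipyramid C a b w t by (rule bp)
  interpret sw: bipyramid C b a w "1 - t" by (rule swap)
  obtain \<phi> \<psi> where iso: "\<forall>F. F face_of P \<longrightarrow> \<phi> F face_of convex hull V"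
      "\<forall>G. G face_of convex hull V \<longrightarrow> \<psi> G face_of P"
      "\<forall>G. G face_of convex hull V \<longrightarrow> \<phi> (\<psi> G) = G"
      "\<forall>F G. F face_of P \<longrightarrow> G face_of P \<longrightarrow> (F \<subseteq> G \<longleftrightarrow> \<phi> F \<subseteq> \<phi> G)"
    by (rule combinatorially_equivalent_iso[OF assms(3)[unfolded D]])
  note \<phi> = iso(1)[rule_format] and \<psi> = iso(2,3)[rule_format] and mono = iso(4)[rule_format]
  have "\<forall>v\<in>V. \<exists>x. x extreme_point_of P \<and> \<phi> {x} = {v}"
  proof
    fix v assume "v \<in> V"
    then have v: "v extreme_point_of convex hull V"
      using extreme_point card assms(4) by simp
    show "\<exists>x. x extreme_point_of P \<and> \<phi> {x} = {v}"
      by (rule combinatorially_equivalent_vertex[OF P(1) \<psi> mono]) (assumption | rule v)+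
  qed
  then obtain g where "\<forall>v\<in>V. g v extreme_point_of P \<and> \<phi> {g v} = {v}"
    by (rule bchoice[THEN exE])
  then have g: "\<And>v. v \<in> V \<Longrightarrow> g v extreme_point_of P" "\<And>v. v \<in> V \<Longrightarrow> \<phi> {g v} = {v}"
    by blast+
  have inj: "inj_on g V"
    by (rule inj_onI) (metis g(2) singleton_inject)
  \<comment> \<open>Two more points than the dimension of the space, hence affinely
    dependent.\<close>
  have "card (g ` V) = DIM('a) + 2"
    using card_image[OF inj] card_vertices card by simp
  then have "affine_dependent (g ` V)"
    using finite_vertices by (intro affine_dependent_biggerset) auto
  then obtain u' where u': "sum u' (g ` V) = 0" "\<exists>x\<in>g ` V. u' x \<noteq> 0"
      "(\<Sum>x\<in>g ` V. u' x *\<^sub>R x) = 0"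
    unfolding affine_dependent_explicit_finite[OF finite_imageI[OF finite_vertices]] by blast
  define u where "u = u' \<circ> g"
  have u: "sum u V = 0" "(\<Sum>v\<in>V. u v *\<^sub>R g v) = 0"
    using u'(1,3) unfolding u_def sum.reindex[OF inj] by (simp_all only: o_def)
  have nz: "\<exists>v\<in>V. u v \<noteq> 0"
    using u'(2) by (auto simp: u_def)
  \<comment> \<open>The swapped interpretation lists the apices in the other order; this rewrites
    its facts to \<open>V\<close>.\<close>
  have VV: "insert b (insert a C) = V"
    by (rule insert_commute)
  have ub: "u q + u b = 0" if q: "q \<in> C" for q
    by (rule slack_column[OF P slack \<phi> \<psi> mono g q])
      (assumption | rule affine_dependency_slack[OF u _ q])+
  have ua: "u q + u a = 0" if q: "q \<in> C" for q
    by (rule sw.slack_column[unfolded VV, OF P slack \<phi> \<psi> mono g q])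
      (assumption | rule sw.affine_dependency_slack[unfolded VV, OF u _ q])+
  obtain q where "q \<in> C"
    using card assms(4) by fastforce
  then have uab: "u a = u b"
    using ua ub by fastforce
  have uC: "u q = - u a" if "q \<in> C" for q
    using ua[OF that] by simp
  \<comment> \<open>Every coefficient is \<open>u a\<close> or \<open>- u a\<close>, so
    \<open>u a = 0\<close> would make the dependency trivial.\<close>
  have "u a \<noteq> 0"
    using nz uC uab by auto
  have "a \<notin> C" "b \<notin> C"
    using apex_a apex_b hull_inc by metis+
  then have "sum u V = u a + (u b + sum u C)"
    using finite_base apices_distinct by simp
  also have "sum u C = - (real (card C) * u a)"
    using uC by simp
  finally have "(2 - real (card C)) * u a = 0"
    using u(1) uab by (simp add: algebra_simps)
  then show ?thesis
    using \<open>u a \<noteq> 0\<close> card by simp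
qed

section \<open>The unit cube\<close>

lemma mem_unit_cube: "x \<in> cbox 0 (One::'a::euclidean_space) \<longleftrightarrow> (\<forall>i\<in>Basis. 0 \<le> x \<bullet> i \<and> x \<bullet> i \<le> 1)"
  by (simp add: mem_box)

text \<open>The cube is the hull of the 0/1 vectors, and extreme points of a hull belong to the
  generating set.\<close>

lemma extreme_point_unit_cube:
  fixes x :: "'a::euclidean_space"
  assumes "x extreme_point_of cbox 0 One" "i \<in> Basis"
  shows "x \<bullet> i \<in> {0, 1}"
  using assms extreme_point_of_convex_hull unfolding unit_interval_convex_hull by blast

lemma two_level_unit_cube: "two_level (cbox 0 (One::'a::euclidean_space))"
proof -
  let ?P = "cbox 0 (One::'a)" and ?n = "DIM('a)"
  let ?E = "{x. x extreme_point_of ?P}"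
  obtain e where e: "bij_betw e {..<?n} (Basis :: 'a set)"
    using ex_bij_betw_nat_finite[of "Basis :: 'a set"] by (auto simp: lessThan_atLeast0)
  have eB: "e j \<in> Basis" if "j < ?n" for j
    using bij_betwE[OF e] that by blast
  have ee: "e i \<bullet> e j = (if i = j then 1 else 0)" if "i < ?n" "j < ?n" for i j
    using inner_Basis[OF eB eB, OF that] that inj_on_eq_iff[OF bij_betw_imp_inj_on[OF e]] by simp
  have Be: "\<exists>j<?n. i = e j" if "i \<in> Basis" for i
    using bij_betw_imp_surj_on[OF e] that by blast
  \<comment> \<open>The first \<open>?n\<close> inequalities bound the coordinates below by 0, the
    last \<open>?n\<close> bound them above by 1.\<close>
  define a where "a j = (if j < ?n then - e j else e (j - ?n))" for j
  define \<beta> :: "nat \<Rightarrow> real" where "\<beta> j = (if j < ?n then 0 else 1)" for j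
  have slack: "\<beta> j - a j \<bullet> x = (if j < ?n then x \<bullet> e j else 1 - x \<bullet> e (j - ?n))" for j x
    by (simp add: a_def \<beta>_def inner_commute)
  have mem: "x \<in> ?P \<longleftrightarrow> (\<forall>j<2 * ?n. \<beta> j - a j \<bullet> x \<ge> 0)" for x
  proof
    assume "x \<in> ?P"
    then show "\<forall>j<2 * ?n. \<beta> j - a j \<bullet> x \<ge> 0"
      unfolding slack mem_unit_cube using eB by simp
  next
    assume *: "\<forall>j<2 * ?n. \<beta> j - a j \<bullet> x \<ge> 0"
    have "0 \<le> x \<bullet> e j \<and> x \<bullet> e j \<le> 1" if "j < ?n" for j
      using *[unfolded slack, rule_format, of j] *[unfolded slack, rule_format, of "?n + j"] that
      by simp
    then show "x \<in> ?P"
      unfolding mem_unit_cube using Be by blast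
  qed
  have irr: "{x. \<forall>j\<in>{..<2 * ?n} - {k}. \<beta> j - a j \<bullet> x \<ge> 0} \<noteq> ?P" if k: "k < 2 * ?n" for k
  proof -
    \<comment> \<open>This point has a single nonzero coordinate, -1 or 2, and violates inequality
      \<open>k\<close> alone.\<close>
    define x where "x = (if k < ?n then - e k else 2 *\<^sub>R e (k - ?n))"
    have "\<beta> j - a j \<bullet> x \<ge> 0" if "j < 2 * ?n" "j \<noteq> k" for j
      using k that unfolding slack x_def by (auto simp: ee)
    moreover have "\<not> \<beta> k - a k \<bullet> x \<ge> 0"
      using k unfolding slack x_def by (auto simp: ee)
    ultimately show ?thesis
      using mem k by blast
  qed
  have "irredundant_representation ?P (2 * ?n) a \<beta>"
    unfolding irredundant_representation_def using mem irr by blast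
  moreover have "finite ?E"
    using finite_polyhedron_extreme_points polytope_imp_polyhedron polytope_interval by blast
  then obtain p where p: "bij_betw p {..<card ?E} ?E"
    using ex_bij_betw_nat_finite by (metis lessThan_atLeast0)
  moreover have "aff_dim ?P = int ?n"
    by (intro aff_dim_nonempty_interior) (simp add: box_ne_empty)
  ultimately have "slack_matrix_of ?P (card ?E) (2 * ?n) (\<lambda>i j. \<beta> j - a j \<bullet> p i)"
    unfolding slack_matrix_of_def using polytope_interval by blast
  moreover have "\<beta> j - a j \<bullet> p i \<in> {0, 1}" if "i < card ?E" "j < 2 * ?n" for i j
  proof -
    have "p i extreme_point_of ?P"
      using bij_betwE[OF p] that(1) by blast
    then show ?thesis
      using extreme_point_unit_cube[of "p i"] eB that(2) unfolding slack
      by (smt (verit) insert_iff less_diff_conv2 linorder_not_less mult_2 singletonD)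
  qed
  ultimately show ?thesis
    unfolding two_level_def by blast
qed

text \<open>The base is the diagonal from \<open>0\<close> to \<open>i + j\<close>, the segment is
  the other diagonal, and they cross at the centre \<open>?z\<close>.\<close>

lemma double_simplex_unit_square:
  assumes "DIM('a::euclidean_space) = 2"
  shows "double_simplex 2 (cbox 0 (One::'a))"
proof -
  obtain i j :: 'a where ij: "Basis = {i, j}" "i \<noteq> j"
    using assms card_2_iff by metis
  have B: "i \<in> Basis" "j \<in> Basis"
    using ij by auto
  have inner: "i \<bullet> i = 1" "j \<bullet> j = 1" "i \<bullet> j = 0" "j \<bullet> i = 0"
    using B ij(2) by (auto simp: inner_not_same_Basis)
  have rep: "x = (x \<bullet> i) *\<^sub>R i + (x \<bullet> j) *\<^sub>R j" for x :: 'a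
    using euclidean_representation[of x] ij(2) unfolding ij(1) by simp
  have eqI: "x = y" if "x \<bullet> i = y \<bullet> i" "x \<bullet> j = y \<bullet> j" for x y :: 'a
    using rep[of x] rep[of y] that by simp
  let ?Q = "closed_segment 0 (i + j)" and ?z = "(1/2) *\<^sub>R (i + j)"
  have ij0: "i + j \<noteq> 0"
    using inner by (metis add.right_neutral inner_add_left inner_zero_left zero_neq_one)
  \<comment> \<open>These two line equations have the centre as their only common solution; the
    first also separates \<open>i\<close> from the affine hull of the base.\<close>
  have Qeq: "?Q \<subseteq> {x. x \<bullet> i = x \<bullet> j}" and Req: "closed_segment i j \<subseteq> {x. x \<bullet> i + x \<bullet> j = 1}"
    using inner by (auto simp: in_segment inner_simps)
  have z1: "?z \<in> open_segment 0 (i + j)"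
    unfolding in_segment using ij0 by (auto intro!: exI[of _ "1/2"])
  have z2: "?z \<in> open_segment i j"
    unfolding in_segment using ij(2) by (auto intro!: exI[of _ "1/2"] simp: scaleR_add_right)
  have "(2 - 1) simplex ?Q"
    unfolding simplex using ij0
    by (intro exI[of _ "{0, i + j}"]) (simp add: segment_convex_hull affine_independent_2)
  moreover have "\<not> closed_segment i j \<subseteq> affine hull ?Q"
  proof
    have "?Q \<subseteq> {x. (i - j) \<bullet> x = 0}"
      using Qeq by (auto simp: inner_simps inner_commute)
    then have "affine hull ?Q \<subseteq> {x. (i - j) \<bullet> x = 0}"
      by (intro hull_minimal affine_hyperplane)
    moreover assume "closed_segment i j \<subseteq> affine hull ?Q"
    ultimately have "(i - j) \<bullet> i = 0"
      by blast
    then show False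
      using inner by (simp add: inner_simps)
  qed
  moreover have "closed_segment i j \<inter> ?Q = {?z}"
  proof
    show "closed_segment i j \<inter> ?Q \<subseteq> {?z}"
    proof
      fix x assume "x \<in> closed_segment i j \<inter> ?Q"
      then have "x \<bullet> i = 1/2" "x \<bullet> j = 1/2"
        using Qeq Req by force+
      then show "x \<in> {?z}"
        using inner by (auto intro!: eqI simp: inner_simps)
    qed
    show "{?z} \<subseteq> closed_segment i j \<inter> ?Q"
      using z1 z2 open_segment_def by blast
  qed
  moreover have "?z \<in> rel_interior (closed_segment i j)" "?z \<in> rel_interior ?Q"
    using z1 z2 ij(2) ij0 by (simp_all add: rel_interior_closed_segment del: scaleR_right_distrib)
  moreover have "cbox 0 One = convex hull (?Q \<union> closed_segment i j)"
  proof -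
    \<comment> \<open>The corners of the square are the endpoints of the two diagonals.\<close>
    have "{x. \<forall>k\<in>Basis. x \<bullet> k = 0 \<or> x \<bullet> k = 1} = {0, i + j} \<union> {i, j}" (is "?L = ?R")
    proof
      show "?R \<subseteq> ?L"
        using inner unfolding ij(1) by (simp add: inner_simps)
      show "?L \<subseteq> ?R"
      proof
        fix x assume "x \<in> ?L"
        then have "x \<bullet> i = 0 \<or> x \<bullet> i = 1" "x \<bullet> j = 0 \<or> x \<bullet> j = 1"
          using B by auto
        then show "x \<in> ?R"
          using rep[of x] by auto
      qed
    qed
    then have "cbox 0 (One::'a) = convex hull ({0, i + j} \<union> {i, j})"
      by (simp only: unit_interval_convex_hull)
    also have "\<dots> = convex hull (convex hull {0, i + j} \<union> convex hull {i, j})"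
      by (simp only: hull_Un_left[symmetric] hull_Un_right[symmetric])
    finally show ?thesis
      by (simp only: segment_convex_hull)
  qed
  ultimately show ?thesis
    unfolding double_simplex_def by blast
qed

section \<open>The characterization of the plane\<close>

lemma combinatorially_equivalent_refl: "combinatorially_equivalent P P"
  unfolding combinatorially_equivalent_def by (rule exI[of _ id]) simp

theorem proposition4p4:
  assumes "CARD('n::finite) \<ge> 2"
  shows "(\<exists>P :: (real ^ 'n) set.
            polytope P \<and> aff_dim P = int CARD('n) \<and> two_level P \<and>
            (\<exists>D :: (real ^ 'n) set. double_simplex (int CARD('n)) D \<and>
               combinatorially_equivalent P D))
         \<longleftrightarrow> CARD('n) = 2"
proof
  assume "\<exists>P :: (real ^ 'n) set.
            polytope P \<and> aff_dim P = int CARD('n) \<and> two_level P \<and>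
            (\<exists>D :: (real ^ 'n) set. double_simplex (int CARD('n)) D \<and>
               combinatorially_equivalent P D)"
  then show "CARD('n) = 2"
    using two_level_double_simplex_dimension[where 'a = "real ^ 'n" and 'b = "real ^ 'n"] assms
    by auto
next
  \<comment> \<open>The unit square serves both as the 2-level polytope and as the double
    simplex.\<close>
  let ?P = "cbox 0 One :: (real ^ 'n) set"
  assume "CARD('n) = 2"
  then have D: "double_simplex (int CARD('n)) ?P"
    using double_simplex_unit_square[where 'a = "real ^ 'n"] by simp
  have two: "two_level ?P"
    by (rule two_level_unit_cube)
  then have "polytope ?P" "aff_dim ?P = int CARD('n)"
    using two_level_representation[OF two] by auto
  with two D show "\<exists>P :: (real ^ 'n) set.
            polytope P \<and> aff_dim P = int CARD('n) \<and> two_level P \<and>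
            (\<exists>D :: (real ^ 'n) set. double_simplex (int CARD('n)) D \<and>
               combinatorially_equivalent P D)"
    using combinatorially_equivalent_refl by blast
qed

end
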